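(* For every integer $n \ge 5$, $$\operatorname{ex}_2(n,K_3) = \left\lfloor \frac{(n-1)^2}{4} \right\rfloor + 1 .$$ Moreover, the extremal graphs, i.e. the $n$-vertex graphs $G$ such that $G_2$ is triangle-free and $|E(G_2)|=\operatorname{ex}_2(n,K_3)$, are (up to isomorphism) exactly the complements of the graphs obtained by the following construction: take the Turán graph $T(n-1,2)$ with bipartition $(A,B)$ (either of the two colour classes may play the role of $A$), fix a vertex $a_1 \in A$ and a non-trivial partition $B = B' \cup B''$ (that is, $B'$ and $B''$ are disjoint and both non-empty), remove all edges between $a_1$ and $B'$, and add a new vertex $a_2$ whose neighbourhood is exactly $\{a_1\} \cup B'$.
   Context: All graphs are finite, simple and undirected, and need not be connected. For a graph $G$ and an integer $k\ge 1$, the $k$-distance graph $G_k$ is the graph on vertex set $V(G)$ in which two vertices are adjacent if and only if their distance in $G$ is exactly $k$ (vertices in different components of $G$ are not adjacent in $G_k$). For a fixed graph $H$, define $$\operatorname{ex}_k(n,H):=\max\{|E(G_k)| : |V(G)|=n \text{ and } G_k \text{ is } H\text{-free}\},$$ where $H$-free means containing no subgraph isomorphic to $H$. The Turán graph $T(m,2)$ is the complete bipartite graph on $m$ vertices whose two colour classes have sizes $\lfloor m/2\rfloor$ and $\lceil m/2\rceil$. *)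

theory Defs
  imports Complex_Main "HOL-Library.Extended_Nat"
begin

record 'a ugraph =
  verts :: "'a set"
  edges :: "'a set set"

definition all_pairs :: "'a set \<Rightarrow> 'a set set" where
  "all_pairs V = {e. e \<subseteq> V \<and> card e = 2}"

definition simple_graph :: "'a ugraph \<Rightarrow> bool" where
  "simple_graph G \<longleftrightarrow> finite (verts G) \<and> edges G \<subseteq> all_pairs (verts G)"

definition subgraph :: "'a ugraph \<Rightarrow> 'a ugraph \<Rightarrow> bool" where
  "subgraph S G \<longleftrightarrow> simple_graph S \<and> verts S \<subseteq> verts G \<and> edges S \<subseteq> edges G"

definition isomorphic :: "'a ugraph \<Rightarrow> 'b ugraph \<Rightarrow> bool" where
  "isomorphic G H \<longleftrightarrow>
     (\<exists>f. bij_betw f (verts G) (verts H) \<and>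
          (\<forall>u\<in>verts G. \<forall>v\<in>verts G. {u, v} \<in> edges G \<longleftrightarrow> {f u, f v} \<in> edges H))"

definition contains_copy :: "'a ugraph \<Rightarrow> 'b ugraph \<Rightarrow> bool" where
  "contains_copy G H \<longleftrightarrow> (\<exists>S. subgraph S G \<and> isomorphic S H)"

definition complement :: "'a ugraph \<Rightarrow> 'a ugraph" where
  "complement G = \<lparr>verts = verts G, edges = all_pairs (verts G) - edges G\<rparr>"

definition complete_graph :: "nat \<Rightarrow> nat ugraph" where
  "complete_graph m = \<lparr>verts = {..<m}, edges = all_pairs {..<m}\<rparr>"

text \<open>A walk is the list of its vertices; its length is the number of its steps.\<close>

definition walk :: "'a ugraph \<Rightarrow> 'a \<Rightarrow> 'a list \<Rightarrow> 'a \<Rightarrow> bool" where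
  "walk G u p v \<longleftrightarrow>
     p \<noteq> [] \<and> hd p = u \<and> last p = v \<and> set p \<subseteq> verts G \<and>
     (\<forall>i. Suc i < length p \<longrightarrow> {p ! i, p ! Suc i} \<in> edges G)"

text \<open>The distance of vertices in different components is \<open>\<infinity>\<close>, the infimum of the empty set.\<close>

definition distance :: "'a ugraph \<Rightarrow> 'a \<Rightarrow> 'a \<Rightarrow> enat" where
  "distance G u v = Inf {enat (length p - 1) | p. walk G u p v}"

definition distance_graph :: "nat \<Rightarrow> 'a ugraph \<Rightarrow> 'a ugraph" where
  "distance_graph k G =
     \<lparr>verts = verts G,
      edges = {{u, v} | u v. u \<in> verts G \<and> v \<in> verts G \<and> u \<noteq> v \<and> distance G u v = enat k}\<rparr>"

definition admissible :: "nat \<Rightarrow> nat \<Rightarrow> 'b ugraph \<Rightarrow> 'a ugraph \<Rightarrow> bool" where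
  "admissible k n H G \<longleftrightarrow>
     simple_graph G \<and> card (verts G) = n \<and> \<not> contains_copy (distance_graph k G) H"

text \<open>Every finite graph is isomorphic to one with vertices in \<^typ>\<open>nat\<close>, so the maximum may be
  taken over those. It ranges over a finite set of numbers, as a graph on \<open>n\<close> vertices has at most
  \<open>n choose 2\<close> edges.\<close>

definition ex_dist :: "nat \<Rightarrow> nat \<Rightarrow> 'b ugraph \<Rightarrow> nat" where
  "ex_dist k n H = Max {card (edges (distance_graph k G)) | G :: nat ugraph. admissible k n H G}"

definition extremal :: "nat \<Rightarrow> nat \<Rightarrow> 'b ugraph \<Rightarrow> 'a ugraph \<Rightarrow> bool" where
  "extremal k n H G \<longleftrightarrow>
     admissible k n H G \<and> card (edges (distance_graph k G)) = ex_dist k n H"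

definition complete_bipartite :: "'a set \<Rightarrow> 'a set \<Rightarrow> 'a ugraph" where
  "complete_bipartite A B = \<lparr>verts = A \<union> B, edges = {{a, b} | a b. a \<in> A \<and> b \<in> B}\<rparr>"

text \<open>\<open>T\<close> is a Turan graph \<open>T(m,2)\<close> with colour classes \<open>A\<close> and \<open>B\<close>, in either order of sizes.\<close>

definition turan2 :: "nat \<Rightarrow> 'a set \<Rightarrow> 'a set \<Rightarrow> 'a ugraph \<Rightarrow> bool" where
  "turan2 m A B T \<longleftrightarrow>
     finite A \<and> finite B \<and> A \<inter> B = {} \<and>
     (card A = m div 2 \<and> card B = (m + 1) div 2 \<or>
      card A = (m + 1) div 2 \<and> card B = m div 2) \<and>
     T = complete_bipartite A B"

definition split_vertex :: "'a ugraph \<Rightarrow> 'a \<Rightarrow> 'a set \<Rightarrow> 'a \<Rightarrow> 'a ugraph" where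
  "split_vertex T a1 B' a2 =
     \<lparr>verts = insert a2 (verts T),
      edges = (edges T - {{a1, b} | b. b \<in> B'}) \<union> {{a2, v} | v. v \<in> {a1} \<union> B'}\<rparr>"

definition split_turan :: "nat \<Rightarrow> 'a ugraph set" where
  "split_turan n =
     {split_vertex T a1 B' a2 | T A B a1 B' B'' a2.
        turan2 (n - 1) A B T \<and> a1 \<in> A \<and>
        B = B' \<union> B'' \<and> B' \<inter> B'' = {} \<and> B' \<noteq> {} \<and> B'' \<noteq> {} \<and>
        a2 \<notin> verts T}"

end

theory Submission
  imports Defs
begin

text \<open>Let \<open>F = G\<^sub>2\<close> be triangle-free with more than \<open>(n - 1)\<^sup>2 / 4\<close> edges. Double counting degrees
  gives an edge \<open>xy\<close> of \<open>F\<close> with \<open>d(x) + d(y) \<ge> n - 1\<close>, so the disjoint independent sets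
  \<open>A = N(y)\<close> and \<open>B = N(x)\<close> miss at most one vertex \<open>z\<close>. If \<open>z\<close> does not exist or has no neighbour
  in one of \<open>A\<close>, \<open>B\<close>, then \<open>F\<close> is bipartite; but every edge of \<open>F\<close> needs a common neighbour in
  \<open>G\<close>, which forces enough cross pairs outside \<open>F\<close> to leave at most \<open>(n - 1)\<^sup>2 / 4\<close> edges. Otherwise
  \<open>z\<close> has \<open>s \<ge> 1\<close> neighbours in \<open>A\<close> and \<open>t \<ge> 1\<close> in \<open>B\<close>, no edge joins these two sets, and
  \<open>|E(F)| \<le> |A||B| - st + s + t = |A||B| + 1 - (s - 1)(t - 1)\<close>. Equality means \<open>s = 1\<close> or \<open>t = 1\<close>
  together with balanced \<open>A\<close>, \<open>B\<close> and all other cross edges present, which is the split Turan graph.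
  Finally, the requirement that the edges of \<open>F\<close> have common neighbours forces \<open>G\<close> to
  contain every non-edge of \<open>F\<close>.\<close>

section \<open>Counting edges\<close>

lemma pair_in_all_pairs: "{u, v} \<in> all_pairs V \<longleftrightarrow> u \<in> V \<and> v \<in> V \<and> u \<noteq> v"
  by (auto simp: all_pairs_def card_insert_if)

lemma all_pairs_elim:
  assumes "e \<in> all_pairs V"
  obtains u v where "e = {u, v}" "u \<in> V" "v \<in> V" "u \<noteq> v"
  using assms by (auto simp: all_pairs_def card_2_iff)

lemma finite_all_pairs: "finite V \<Longrightarrow> finite (all_pairs V)"
  by (rule finite_subset[of _ "Pow V"]) (auto simp: all_pairs_def)

lemma edge_in_verts:
  assumes "E \<subseteq> all_pairs V" "{u, v} \<in> E"
  shows "u \<in> V" "v \<in> V" "u \<noteq> v"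
  using assms pair_in_all_pairs by (metis subsetD)+

text \<open>Each edge has two orientations. The oriented edges form a \<open>Sigma\<close> set over
  the vertices, which is how degrees enter the counts.\<close>

lemma card_ordered_edges:
  assumes "finite V" "E \<subseteq> all_pairs V"
  shows "card {(u, v). {u, v} \<in> E} = 2 * card E"
proof -
  have fE: "finite E"
    using assms finite_all_pairs finite_subset by blast
  have two: "finite {(u, v). {u, v} = e} \<and> card {(u, v). {u, v} = e} = 2" if e: "e \<in> E" for e
  proof -
    obtain a b where ab: "e = {a, b}" "a \<noteq> b"
      using e assms(2) by (blast elim: all_pairs_elim)
    have "{(u, v). {u, v} = e} = {(a, b), (b, a)}"
      using ab by (auto simp: doubleton_eq_iff)
    then show ?thesis
      using ab by (simp add: card_insert_if)
  qed
  have "{(u, v). {u, v} \<in> E} = (\<Union>e\<in>E. {(u, v). {u, v} = e})"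
    by auto
  also have "card \<dots> = (\<Sum>e\<in>E. card {(u, v). {u, v} = e})"
    by (rule card_UN_disjoint) (use fE two in auto)
  finally show ?thesis
    using two by simp
qed

text \<open>Disjointness of \<open>X\<close> and \<open>Y\<close> gives each edge exactly one
  orientation from \<open>X\<close> to \<open>Y\<close>, so edges can be counted inside a
  product.\<close>

lemma card_bipartite_edges:
  assumes "X \<inter> Y = {}" "\<And>e. e \<in> E \<Longrightarrow> \<exists>x\<in>X. \<exists>y\<in>Y. e = {x, y}"
  shows "card E = card {(x, y). x \<in> X \<and> y \<in> Y \<and> {x, y} \<in> E}"
proof -
  let ?P = "{(x, y). x \<in> X \<and> y \<in> Y \<and> {x, y} \<in> E}"
  have "inj_on (\<lambda>(x, y). {x, y}) ?P"
    using assms(1) by (auto simp: inj_on_def doubleton_eq_iff)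
  moreover have "(\<lambda>(x, y). {x, y}) ` ?P = E"
    using assms(2) by fastforce
  ultimately show ?thesis
    using card_image by fastforce
qed

section \<open>Products of two numbers with a given sum\<close>

lemma four_mult_le_square_sum: "4 * (a * b) \<le> (a + b)\<^sup>2" for a b :: nat
proof -
  have "0 \<le> (int a - int b)\<^sup>2"
    by simp
  then have "int (4 * (a * b)) \<le> int ((a + b)\<^sup>2)"
    by (simp add: power2_eq_square algebra_simps)
  then show ?thesis
    by linarith
qed

lemma mult_le_quarter_square: "a * b \<le> (a + b)\<^sup>2 div 4" for a b :: nat
  using four_mult_le_square_sum[of a b] by linarith

text \<open>By 4ab = m^2 - (a - b)^2, the product reaches the rounded quarter of m^2 exactly when
  the two numbers differ by at most 1.\<close>

lemma balanced_iff_mult_eq: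
  fixes a b m :: nat
  assumes "a + b = m"
  shows "a * b = m\<^sup>2 div 4 \<longleftrightarrow>
    a = m div 2 \<and> b = (m + 1) div 2 \<or> a = (m + 1) div 2 \<and> b = m div 2"
    (is "?L \<longleftrightarrow> ?R")
proof
  assume ?L
  \<comment> \<open>The remainder modulo 4 is at most 3, so (a - b)^2 <= 3 < 4.\<close>
  then have "m\<^sup>2 \<le> 4 * (a * b) + 3"
    by linarith
  then have "int (m\<^sup>2) \<le> int (4 * (a * b) + 3)"
    by linarith
  then have "(int a - int b)\<^sup>2 \<le> 3"
    unfolding assms[symmetric] by (simp add: power2_eq_square algebra_simps)
  then have "(int a - int b)\<^sup>2 < 2\<^sup>2"
    by simp
  then have "\<bar>int a - int b\<bar> < 2"
    by (metis power2_abs power_less_imp_less_base zero_le_numeral)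
  then have "a = b \<or> a = b + 1 \<or> b = a + 1"
    by linarith
  then show ?R
    using assms by auto
next
  assume R: ?R
  show ?L
  proof (cases "even m")
    case True
    then obtain k where k: "m = 2 * k" ..
    then show ?thesis
      using R by (auto simp: power2_eq_square)
  next
    case False
    then obtain k where k: "m = 2 * k + 1"
      using oddE by blast
    have "m\<^sup>2 = 4 * (k * k + k) + 1"
      unfolding k by (simp add: power2_eq_square algebra_simps)
    then have "m\<^sup>2 div 4 = k * k + k"
      by simp
    then show ?thesis
      using R k by auto
  qed
qed

text \<open>Summing d(u) + d(v) over the m = 2|E| oriented edges gives twice the sum of d(u)^2,
  hence at most mk. By Cauchy-Schwarz the sum of squares is at least m^2/|V|, and cancelling m
  leaves 2m <= |V|k.\<close>

lemma card_edges_le_of_degree_sums: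
  fixes E :: "'a set set"
  assumes fin: "finite V" and E: "E \<subseteq> all_pairs V"
    and deg: "\<And>u v. {u, v} \<in> E \<Longrightarrow> card {w. {u, w} \<in> E} + card {w. {v, w} \<in> E} \<le> k"
  shows "4 * card E \<le> card V * k"
proof -
  define N where "N u = {w. {u, w} \<in> E}" for u
  define d where "d u = card (N u)" for u
  define m where "m = 2 * card E"
  define D where "D = {(u, v). {u, v} \<in> E}"
  have D: "D = Sigma V N"
    using edge_in_verts[OF E] by (auto simp: D_def N_def)
  have NV: "N u \<subseteq> V" for u
    using edge_in_verts[OF E] by (auto simp: N_def)
  have finN: "finite (N u)" for u
    using NV fin finite_subset by blast
  have cD: "card D = m"
    using card_ordered_edges[OF fin E] by (simp add: D_def m_def)
  have md: "m = (\<Sum>u\<in>V. d u)"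
    using cD D fin finN by (simp add: d_def)
  \<comment> \<open>A vertex \<open>u\<close> is the first component of \<open>d u\<close> oriented
    edges and contributes \<open>d u\<close> each time; by reversal the second components give the
    same total.\<close>
  have first: "(\<Sum>(u, v)\<in>D. d u) = (\<Sum>u\<in>V. (d u)\<^sup>2)"
    unfolding D using fin finN by (subst sum.Sigma[symmetric]) (auto simp: d_def power2_eq_square)
  have second: "(\<Sum>(u, v)\<in>D. d v) = (\<Sum>(u, v)\<in>D. d u)"
    by (rule sum.reindex_bij_witness[of _ prod.swap prod.swap])
      (auto simp: D_def insert_commute)
  have "2 * (\<Sum>u\<in>V. (d u)\<^sup>2) = (\<Sum>(u, v)\<in>D. d u + d v)"
    using first second by (simp add: sum.distrib split_def)
  also have "\<dots> \<le> (\<Sum>p\<in>D. k)"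
    by (rule sum_mono) (use deg in \<open>auto simp: D_def d_def N_def\<close>)
  finally have up: "2 * (\<Sum>u\<in>V. (d u)\<^sup>2) \<le> m * k"
    using cD by simp
  have low: "m\<^sup>2 \<le> card V * (\<Sum>u\<in>V. (d u)\<^sup>2)"
  proof (cases "card V = 0")
    case True
    then show ?thesis
      using fin md by simp
  next
    case False
    let ?n = "int (card V)" and ?m = "int m" and ?Q = "\<Sum>u\<in>V. (int (d u))\<^sup>2"
    have s: "(\<Sum>u\<in>V. int (d u)) = ?m"
      by (simp add: md)
    \<comment> \<open>Cauchy-Schwarz from the squared deviations of the degrees from their mean,
      scaled by the number of vertices and taken in the integers so that subtraction is
      exact.\<close>
    have "0 \<le> (\<Sum>u\<in>V. (?n * int (d u) - ?m)\<^sup>2)"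
      by (simp add: sum_nonneg)
    also have "\<dots> = (\<Sum>u\<in>V. ?n\<^sup>2 * (int (d u))\<^sup>2 - 2 * ?n * ?m * int (d u) + ?m\<^sup>2)"
      by (rule sum.cong) (auto simp: power2_eq_square algebra_simps)
    also have "\<dots> = ?n\<^sup>2 * ?Q - 2 * ?n * ?m * ?m + ?n * ?m\<^sup>2"
      by (simp add: sum.distrib sum_subtractf sum_distrib_left[symmetric] s)
    also have "\<dots> = ?n * (?n * ?Q - ?m\<^sup>2)"
      by (simp add: power2_eq_square algebra_simps)
    finally have "0 \<le> ?n * ?Q - ?m\<^sup>2"
      using False by (simp add: zero_le_mult_iff)
    then have "int (m\<^sup>2) \<le> int (card V * (\<Sum>u\<in>V. (d u)\<^sup>2))"
      by simp
    then show ?thesis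
      by linarith
  qed
  have "2 * m\<^sup>2 \<le> card V * (2 * (\<Sum>u\<in>V. (d u)\<^sup>2))"
    using low by simp
  also have "\<dots> \<le> card V * (m * k)"
    using up by simp
  finally have "m * (2 * m) \<le> m * (card V * k)"
    by (simp add: power2_eq_square algebra_simps)
  then show ?thesis
    by (cases "m = 0") (auto simp: m_def mult.commute)
qed

section \<open>Distance two and triangles\<close>

text \<open>A walk with one step is an edge and one with two steps passes through a common
  neighbour, so the infimum over all walks is 2 exactly when the second kind exists and the first
  does not.\<close>

lemma distance_eq_2_iff:
  assumes G: "edges G \<subseteq> all_pairs (verts G)" and uv: "u \<in> verts G" "v \<in> verts G" "u \<noteq> v"
  shows "distance G u v = enat 2 \<longleftrightarrow>
    {u, v} \<notin> edges G \<and> (\<exists>w. {u, w} \<in> edges G \<and> {w, v} \<in> edges G)"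
    (is "?L \<longleftrightarrow> ?nadj \<and> ?R")
proof -
  let ?W = "{enat (length p - 1) | p. walk G u p v}"
  have one: "\<exists>p. walk G u p v \<and> length p = 2" if "{u, v} \<in> edges G"
    by (rule exI[of _ "[u, v]"]) (use that uv in \<open>auto simp: walk_def\<close>)
  have two: "\<exists>p. walk G u p v \<and> length p = 3" if R: ?R
  proof -
    obtain w where w: "{u, w} \<in> edges G" "{w, v} \<in> edges G"
      using R by blast
    have "walk G u [u, w, v] v"
      using w uv edge_in_verts(1)[OF G w(2)] by (auto simp: walk_def nth_Cons' less_Suc_eq)
    then show ?thesis
      by (intro exI[of _ "[u, w, v]"]) simp
  qed
  \<comment> \<open>\<open>length p\<close> counts vertices, so lists with 2 and 3 entries are walks
    with one and two steps; \<open>u \<noteq> v\<close> rules out a single entry.\<close>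
  have long: "length p \<ge> 2 \<and> (length p = 2 \<longrightarrow> {u, v} \<in> edges G) \<and> (length p = 3 \<longrightarrow> ?R)"
    if p: "walk G u p v" for p
  proof -
    obtain x q where xq: "p = x # q"
      using p by (cases p) (auto simp: walk_def)
    obtain y r where yr: "q = y # r"
      using p xq uv by (cases q) (auto simp: walk_def)
    have step: "{p ! i, p ! Suc i} \<in> edges G" if "Suc i < length p" for i
      using p that by (auto simp: walk_def)
    show ?thesis
    proof (cases r)
      case Nil
      then show ?thesis
        using p xq yr step[of 0] by (auto simp: walk_def)
    next
      case (Cons z s)
      then show ?thesis
        using p xq yr step[of 0] step[of 1] by (auto simp: walk_def)
    qed
  qed
  show ?thesis
  proof
    assume L: ?L
    have "?W \<noteq> {}"
    proof
      assume "?W = {}"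
      then have "distance G u v = \<infinity>"
        unfolding distance_def by (simp add: top_enat_def[symmetric] del: Collect_empty_eq)
      then show False
        using L by simp
    qed
    \<comment> \<open>A non-empty set of extended naturals has a least element, so a shortest walk
      exists.\<close>
    then have "Inf ?W \<in> ?W"
      unfolding Inf_enat_def by (auto simp del: Collect_empty_eq intro: LeastI)
    then obtain p where p: "walk G u p v" "length p - 1 = 2"
      using L by (auto simp: distance_def)
    have "?nadj"
    proof
      assume "{u, v} \<in> edges G"
      then obtain q where "walk G u q v" "length q = 2"
        using one by blast
      then have "enat 1 \<in> ?W"
        by force
      then have "Inf ?W \<le> enat 1"
        by (rule Inf_lower)
      then show False
        using L by (simp add: distance_def)
    qed
    then show "?nadj \<and> ?R"
      using long[OF p(1)] p(2) by auto
  next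
    assume R: "?nadj \<and> ?R"
    then obtain q where q: "walk G u q v" "length q = 3"
      using two by blast
    have "enat 2 \<in> ?W"
      using q by force
    moreover have "enat 2 \<le> x" if x: "x \<in> ?W" for x
    proof -
      obtain p where p: "walk G u p v" "x = enat (length p - 1)"
        using x by blast
      then have "length p \<ge> 3"
        using long[OF p(1)] R by linarith
      then show ?thesis
        using p by simp
    qed
    ultimately show ?L
      unfolding distance_def by (meson Inf_greatest Inf_lower antisym)
  qed
qed

lemma distance_graph_edges_subset: "edges (distance_graph k G) \<subseteq> all_pairs (verts G)"
  by (auto simp: distance_graph_def pair_in_all_pairs)

text \<open>The local form of adjacency in \<open>G\<^sub>2\<close>; later arguments about distance
  two go through it. Membership of the vertices follows from the edge conditions.\<close>

lemma distance_graph_2_edge_iff: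
  assumes G: "edges G \<subseteq> all_pairs (verts G)"
  shows "{u, v} \<in> edges (distance_graph 2 G) \<longleftrightarrow>
    u \<noteq> v \<and> {u, v} \<notin> edges G \<and> (\<exists>w. {u, w} \<in> edges G \<and> {w, v} \<in> edges G)"
proof (cases "u \<in> verts G \<and> v \<in> verts G \<and> u \<noteq> v")
  case True
  \<comment> \<open>An edge of the distance graph may be presented with its ends in either order, so
    the condition must be symmetric.\<close>
  have sym: "distance G v u = enat 2 \<longleftrightarrow> distance G u v = enat 2"
    using True by (subst (1 2) distance_eq_2_iff[OF G]) (auto simp: insert_commute)
  have "{u, v} \<in> edges (distance_graph 2 G) \<longleftrightarrow> distance G u v = enat 2"
    using True sym by (auto simp: distance_graph_def doubleton_eq_iff)
  then show ?thesis
    using True distance_eq_2_iff[OF G] by auto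
next
  case False
  then show ?thesis
    using edge_in_verts[OF G] edge_in_verts[OF distance_graph_edges_subset[of 2 G]] by blast
qed

text \<open>The preimages of 0, 1, 2 form the triangle; conversely the three vertices are distinct
  because edges are not loops.\<close>

lemma contains_triangle_iff:
  assumes F: "edges F \<subseteq> all_pairs (verts F)"
  shows "contains_copy F (complete_graph 3) \<longleftrightarrow>
    (\<exists>u v w. {u, v} \<in> edges F \<and> {v, w} \<in> edges F \<and> {u, w} \<in> edges F)"
proof
  assume "contains_copy F (complete_graph 3)"
  then obtain S f where S: "subgraph S F" and f: "bij_betw f (verts S) {..<3::nat}"
    and iso: "\<And>u v. u \<in> verts S \<Longrightarrow> v \<in> verts S \<Longrightarrow>
      {u, v} \<in> edges S \<longleftrightarrow> {f u, f v} \<in> all_pairs {..<3}"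
    unfolding contains_copy_def isomorphic_def complete_graph_def by auto
  have "i \<in> f ` verts S" if "i < 3" for i
    using f that by (auto simp: bij_betw_def)
  from this[of 0] this[of 1] this[of 2]
  obtain u v w where uvw: "u \<in> verts S" "v \<in> verts S" "w \<in> verts S" "f u = 0" "f v = 1" "f w = 2"
    by auto
  then have "{u, v} \<in> edges S \<and> {v, w} \<in> edges S \<and> {u, w} \<in> edges S"
    using iso by (simp add: pair_in_all_pairs)
  then show "\<exists>u v w. {u, v} \<in> edges F \<and> {v, w} \<in> edges F \<and> {u, w} \<in> edges F"
    using S by (meson subgraph_def subsetD)
next
  assume "\<exists>u v w. {u, v} \<in> edges F \<and> {v, w} \<in> edges F \<and> {u, w} \<in> edges F"
  then obtain u v w where e: "{u, v} \<in> edges F" "{v, w} \<in> edges F" "{u, w} \<in> edges F"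
    by blast
  note d = edge_in_verts[OF F e(1)] edge_in_verts[OF F e(2)] edge_in_verts[OF F e(3)]
  define S where "S = \<lparr>verts = {u, v, w}, edges = {{u, v}, {v, w}, {u, w}}\<rparr>"
  define f where "f x = (if x = u then 0 else if x = v then 1 else 2 :: nat)" for x
  have "subgraph S F"
    using e d by (simp add: subgraph_def simple_graph_def S_def pair_in_all_pairs)
  moreover have "bij_betw f (verts S) (verts (complete_graph 3))"
    using d by (auto simp: bij_betw_def inj_on_def S_def f_def complete_graph_def)
  moreover have "\<forall>x\<in>verts S. \<forall>y\<in>verts S. {x, y} \<in> edges S \<longleftrightarrow> {f x, f y} \<in> edges (complete_graph 3)"
    using d by (auto simp: S_def f_def complete_graph_def pair_in_all_pairs doubleton_eq_iff)
  ultimately show "contains_copy F (complete_graph 3)"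
    unfolding contains_copy_def isomorphic_def by blast
qed

section \<open>Bipartite 2-distance graphs\<close>

text \<open>With \<open>p \<ge> q\<close> the numbers of vertices of \<open>X\<close> and \<open>Y\<close> having a \<open>g\<close>-neighbour across, the
  count is \<open>p (|Y| - 1) + (|X| - p) q \<le> p (|X| + |Y| - 1 - p)\<close>.\<close>

lemma card_cross_pairs_le:
  assumes fin: "finite X" "finite Y"
    and P: "\<And>x y. (x, y) \<in> P \<Longrightarrow>
      x \<in> X \<and> y \<in> Y \<and> \<not> g x y \<and> ((\<exists>y'\<in>Y. g x y') \<or> (\<exists>x'\<in>X. g x' y))"
    and le: "card {y\<in>Y. \<exists>x\<in>X. g x y} \<le> card {x\<in>X. \<exists>y\<in>Y. g x y}"
  shows "card P \<le> (card X + card Y - 1)\<^sup>2 div 4"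
proof -
  define X1 Y1 where "X1 = {x\<in>X. \<exists>y\<in>Y. g x y}" and "Y1 = {y\<in>Y. \<exists>x\<in>X. g x y}"
  have "\<forall>x\<in>X1. \<exists>y. y \<in> Y \<and> g x y"
    by (auto simp: X1_def)
  then obtain h where h: "\<And>x. x \<in> X1 \<Longrightarrow> h x \<in> Y \<and> g x (h x)"
    by metis
  have fin1: "finite X1" "finite Y1" "X1 \<subseteq> X"
    using fin by (auto simp: X1_def Y1_def)
  \<comment> \<open>A pair with \<open>x\<close> in \<open>X1\<close> has \<open>y\<close> different
    from \<open>h x\<close>; a pair with \<open>x\<close> outside \<open>X1\<close> owes its cross
    neighbour to \<open>y\<close>, which puts \<open>y\<close> in \<open>Y1\<close>.\<close>
  have "P \<subseteq> (SIGMA x:X1. Y - {h x}) \<union> (X - X1) \<times> Y1"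
  proof
    fix p assume "p \<in> P"
    then obtain x y where p: "p = (x, y)" "(x, y) \<in> P"
      by (cases p) auto
    show "p \<in> (SIGMA x:X1. Y - {h x}) \<union> (X - X1) \<times> Y1"
      using P[OF p(2)] h[of x] by (auto simp: p(1) X1_def Y1_def)
  qed
  then have "card P \<le> card ((SIGMA x:X1. Y - {h x}) \<union> (X - X1) \<times> Y1)"
    using fin fin1 by (intro card_mono) auto
  also have "\<dots> \<le> card (SIGMA x:X1. Y - {h x}) + card ((X - X1) \<times> Y1)"
    by (rule card_Un_le)
  also have "card (SIGMA x:X1. Y - {h x}) = card X1 * (card Y - 1)"
    using fin fin1 h by simp
  also have "card ((X - X1) \<times> Y1) = (card X - card X1) * card Y1"
    using fin1 by (simp add: card_cartesian_product card_Diff_subset)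
  also have "\<dots> \<le> card X1 * (card X - card X1)"
    using le by (simp add: X1_def Y1_def mult.commute)
  finally have bound: "card P \<le> card X1 * (card Y - 1 + (card X - card X1))"
    by (simp add: distrib_left)
  show ?thesis
  proof (cases "X1 = {}")
    case True
    then show ?thesis
      using bound by simp
  next
    case False
    then obtain x where "x \<in> X1"
      by blast
    then have "card Y > 0"
      using h fin card_gt_0_iff by blast
    moreover have "card X1 \<le> card X"
      using fin fin1 card_mono by blast
    \<comment> \<open>Positivity of \<open>card Y\<close> and \<open>card X1 \<le> card X\<close>
      make the natural subtractions exact, so the two factors of the bound have this sum.\<close>
    ultimately have "card X1 + (card Y - 1 + (card X - card X1)) = card X + card Y - 1"
      by simp
    then show ?thesis
      using bound mult_le_quarter_square[of "card X1" "card Y - 1 + (card X - card X1)"]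
      by (metis le_trans)
  qed
qed

text \<open>A common \<open>G\<close>-neighbour of \<open>x\<close> in \<open>X\<close> and
  \<open>y\<close> in \<open>Y\<close> lies in \<open>X\<close> or in \<open>Y\<close>, so it is
  joined in \<open>G\<close> to \<open>y\<close> or to \<open>x\<close> across the bipartition. This
  is the hypothesis of \<open>card_cross_pairs_le\<close>, and it lowers the bipartite maximum n^2/4
  to (n - 1)^2/4.\<close>

lemma card_distance_graph_2_bipartite_le:
  assumes G: "simple_graph G" and V: "verts G = X \<union> Y" "X \<inter> Y = {}"
    and cross: "\<And>u v. {u, v} \<in> edges (distance_graph 2 G) \<Longrightarrow> u \<in> X \<and> v \<in> Y \<or> u \<in> Y \<and> v \<in> X"
  shows "card (edges (distance_graph 2 G)) \<le> (card (verts G) - 1)\<^sup>2 div 4"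
proof -
  let ?E = "edges (distance_graph 2 G)"
  define g where "g u v \<longleftrightarrow> {u, v} \<in> edges G" for u v
  define P where "P = {(x, y). x \<in> X \<and> y \<in> Y \<and> {x, y} \<in> ?E}"
  have GV: "edges G \<subseteq> all_pairs (verts G)" and fin: "finite X" "finite Y"
    using G V by (auto simp: simple_graph_def)
  have gsym: "g u v \<longleftrightarrow> g v u" for u v
    by (simp add: g_def insert_commute)
  have "\<exists>x\<in>X. \<exists>y\<in>Y. e = {x, y}" if e: "e \<in> ?E" for e
  proof -
    obtain u v where uv: "e = {u, v}"
      using e distance_graph_edges_subset by (blast elim: all_pairs_elim)
    then show ?thesis
      using cross[of u v] e by (metis insert_commute)
  qed
  then have cE: "card ?E = card P"
    unfolding P_def by (rule card_bipartite_edges[OF V(2)])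
  have cV: "card (verts G) = card X + card Y"
    using V fin by (simp add: card_Un_disjoint)
  have P: "x \<in> X \<and> y \<in> Y \<and> \<not> g x y \<and> ((\<exists>y'\<in>Y. g x y') \<or> (\<exists>x'\<in>X. g x' y))"
    if xy: "(x, y) \<in> P" for x y
  proof -
    obtain w where w: "g x w" "g w y" and "\<not> g x y" "x \<in> X" "y \<in> Y"
      using xy distance_graph_2_edge_iff[OF GV] by (auto simp: P_def g_def)
    moreover have "w \<in> X \<or> w \<in> Y"
      using w(1) edge_in_verts[OF GV] V by (auto simp: g_def)
    ultimately show ?thesis
      by blast
  qed
  show ?thesis
  proof (cases "card {y\<in>Y. \<exists>x\<in>X. g x y} \<le> card {x\<in>X. \<exists>y\<in>Y. g x y}")
    case True
    then show ?thesis
      using card_cross_pairs_le[OF fin P] cE cV by simp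
  next
    \<comment> \<open>The counting bound expects the side with more such vertices first, so the
      sides are exchanged.\<close>
    case False
    have "card (P\<inverse>) \<le> (card Y + card X - 1)\<^sup>2 div 4"
    proof (rule card_cross_pairs_le[OF fin(2,1)])
      show "y \<in> Y \<and> x \<in> X \<and> \<not> g y x \<and> ((\<exists>x'\<in>X. g y x') \<or> (\<exists>y'\<in>Y. g y' x))"
        if "(y, x) \<in> P\<inverse>" for y x
        using P[of x y] that gsym by blast
      show "card {x\<in>X. \<exists>y\<in>Y. g y x} \<le> card {y\<in>Y. \<exists>x\<in>X. g y x}"
        using False gsym by simp
    qed
    then show ?thesis
      using cE cV by (simp add: card_inverse add.commute)
  qed
qed

section \<open>Split Turan graphs\<close>

lemma ugraph_eqI:
  fixes F F' :: "'a ugraph"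
  assumes "verts F = verts F'" "edges F \<subseteq> all_pairs (verts F)" "edges F' \<subseteq> all_pairs (verts F')"
    and "\<And>u v. u \<in> verts F \<Longrightarrow> v \<in> verts F \<Longrightarrow> u \<noteq> v \<Longrightarrow> {u, v} \<in> edges F \<longleftrightarrow> {u, v} \<in> edges F'"
  shows "F = F'"
proof -
  have "e \<in> edges F \<longleftrightarrow> e \<in> edges F'" for e
    using assms by (blast elim: all_pairs_elim)
  then show ?thesis
    using assms(1) by (intro ugraph.equality) auto
qed

lemma complement_edge_iff:
  "{u, v} \<in> edges (complement F) \<longleftrightarrow>
    u \<in> verts F \<and> v \<in> verts F \<and> u \<noteq> v \<and> {u, v} \<notin> edges F"
  by (auto simp: complement_def pair_in_all_pairs)

lemma complement_edges_subset: "edges (complement F) \<subseteq> all_pairs (verts F)"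
  by (auto simp: complement_def)

lemma verts_complement [simp]: "verts (complement F) = verts F"
  by (simp add: complement_def)

lemma verts_distance_graph [simp]: "verts (distance_graph k G) = verts G"
  by (simp add: distance_graph_def)

lemma pair_in_Collect_pairs: "{u, v} \<in> {{a, b} | a b. P a b} \<longleftrightarrow> P u v \<or> P v u"
  by (auto simp: doubleton_eq_iff)

lemma pair_in_Collect_pairs_at:
  "{u, v} \<in> {{a, b} | b. P b} \<longleftrightarrow> u = a \<and> P v \<or> v = a \<and> P u"
  by (auto simp: doubleton_eq_iff)

text \<open>The data of the construction, with \<open>B' \<noteq> B\<close> standing for a non-empty
  \<open>B''\<close>. Balance of the classes is added in \<open>split_turan_iff\<close>.\<close>

locale split_config =
  fixes A B :: "'a set" and a1 :: 'a and B' :: "'a set" and a2 :: 'a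
  assumes fin: "finite A" "finite B" and disj: "A \<inter> B = {}"
    and a1: "a1 \<in> A" and B': "B' \<subseteq> B" "B' \<noteq> {}" "B' \<noteq> B"
    and a2: "a2 \<notin> A" "a2 \<notin> B"
begin

definition split_graph :: "'a ugraph" where
  "split_graph = split_vertex (complete_bipartite A B) a1 B' a2"

lemma verts_split_graph: "verts split_graph = insert a2 (A \<union> B)"
  by (simp add: split_graph_def split_vertex_def complete_bipartite_def)

lemma split_graph_edge_iff:
  "{u, v} \<in> edges split_graph \<longleftrightarrow>
    u \<in> A \<and> v \<in> B \<and> \<not> (u = a1 \<and> v \<in> B') \<or> v \<in> A \<and> u \<in> B \<and> \<not> (v = a1 \<and> u \<in> B') \<or>
    u = a2 \<and> (v = a1 \<or> v \<in> B') \<or> v = a2 \<and> (u = a1 \<or> u \<in> B')"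
proof -
  have "{u, v} \<in> edges split_graph \<longleftrightarrow>
      (u \<in> A \<and> v \<in> B \<or> v \<in> A \<and> u \<in> B) \<and> \<not> (u = a1 \<and> v \<in> B' \<or> v = a1 \<and> u \<in> B') \<or>
      u = a2 \<and> v \<in> {a1} \<union> B' \<or> v = a2 \<and> u \<in> {a1} \<union> B'"
    unfolding split_graph_def split_vertex_def complete_bipartite_def ugraph.simps
      Un_iff[of "{u, v}"] Diff_iff pair_in_Collect_pairs pair_in_Collect_pairs_at ..
  then show ?thesis
    using disj a1 B' by blast
qed

lemma split_graph_edges_subset: "edges split_graph \<subseteq> all_pairs (verts split_graph)"
  using disj a1 B' a2
  unfolding split_graph_def split_vertex_def complete_bipartite_def
  by (auto simp: pair_in_all_pairs)

lemma card_verts_split_graph: "card (verts split_graph) = card A + card B + 1"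
  using fin disj a2 by (simp add: verts_split_graph card_Un_disjoint)

text \<open>Splitting removes \<open>card B'\<close> edges at \<open>a1\<close> and adds
  \<open>card B' + 1\<close> edges at \<open>a2\<close>.\<close>

lemma card_edges_split_graph: "card (edges split_graph) = card A * card B + 1"
proof -
  define E0 where "E0 = {{a, b} | a b. a \<in> A \<and> b \<in> B} - {{a1, b} | b. b \<in> B'}"
  define E1 where "E1 = (\<lambda>v. {a2, v}) ` insert a1 B'"
  have finB': "finite B'"
    using fin B' finite_subset by blast
  have E: "edges split_graph = E0 \<union> E1"
    by (auto simp: split_graph_def split_vertex_def complete_bipartite_def E0_def E1_def)
  have disjE: "E0 \<inter> E1 = {}"
  proof -
    have "a2 \<notin> e" if "e \<in> E0" for e
      using that a2 by (auto simp: E0_def)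
    moreover have "a2 \<in> e" if "e \<in> E1" for e
      using that by (auto simp: E1_def)
    ultimately show ?thesis
      by blast
  qed
  have "card E0 = card {(x, y). x \<in> A \<and> y \<in> B \<and> {x, y} \<in> E0}"
    by (rule card_bipartite_edges[OF disj]) (auto simp: E0_def)
  also have "{(x, y). x \<in> A \<and> y \<in> B \<and> {x, y} \<in> E0} = A \<times> B - {a1} \<times> B'"
    unfolding E0_def Diff_iff pair_in_Collect_pairs pair_in_Collect_pairs_at
    using disj a1 B' by auto
  also have "card \<dots> = card A * card B - card B'"
    using a1 B' finB' by (subst card_Diff_subset) (auto simp: card_cartesian_product)
  finally have c0: "card E0 = card A * card B - card B'" .
  \<comment> \<open>Since \<open>A\<close> is non-empty, the subtraction in the size of
    \<open>E0\<close> does not truncate.\<close>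
  have "card B' \<le> card B"
    using fin B' card_mono by blast
  also have "\<dots> \<le> card A * card B"
    using fin a1 by (cases "card A") auto
  finally have le: "card B' \<le> card A * card B" .
  have "card E1 = card (insert a1 B')"
    unfolding E1_def by (rule card_image) (auto simp: inj_on_def doubleton_eq_iff)
  also have "\<dots> = card B' + 1"
    using finB' disj a1 B' by (subst card_insert_disjoint) auto
  finally have c1: "card E1 = card B' + 1" .
  have "finite E0" "finite E1"
    using split_graph_edges_subset E finite_all_pairs[of "verts split_graph"] fin
    by (auto simp: verts_split_graph dest: finite_subset)
  then show ?thesis
    using E disjE c0 c1 le by (simp add: card_Un_disjoint)
qed

text \<open>The neighbours of \<open>a2\<close> are \<open>a1\<close> and \<open>B'\<close>, which
  span no edge after the removal; away from \<open>a2\<close> the graph is bipartite.\<close>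

lemma split_graph_triangle_free:
  "\<not> ({u, v} \<in> edges split_graph \<and> {v, w} \<in> edges split_graph \<and> {u, w} \<in> edges split_graph)"
proof -
  have sym: "{x, y} \<in> edges split_graph \<longleftrightarrow> {y, x} \<in> edges split_graph" for x y
    by (simp add: insert_commute)
  have at_a2: "{x, y} \<notin> edges split_graph"
    if "{a2, x} \<in> edges split_graph" "{a2, y} \<in> edges split_graph" for x y
  proof -
    have "x = a1 \<or> x \<in> B'" "y = a1 \<or> y \<in> B'"
      using that a1 a2 B' unfolding split_graph_edge_iff by blast+
    then show ?thesis
      using disj a1 a2 B' unfolding split_graph_edge_iff by blast
  qed
  have off_a2: "x \<in> A \<and> y \<in> B \<or> x \<in> B \<and> y \<in> A"
    if "{x, y} \<in> edges split_graph" "x \<noteq> a2" "y \<noteq> a2" for x y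
    using that unfolding split_graph_edge_iff by blast
  show ?thesis
  proof (cases "u = a2 \<or> v = a2 \<or> w = a2")
    case True
    then show ?thesis
      using at_a2 sym by metis
  next
    case False
    then show ?thesis
      using off_a2[of u v] off_a2[of v w] off_a2[of u w] disj by blast
  qed
qed

text \<open>Non-edges are adjacent in the complement, so it remains to give every edge a common
  neighbour there. In the complement \<open>B\<close> is a clique, \<open>A - {a1}\<close> is joined
  to both \<open>a1\<close> and \<open>a2\<close>, \<open>B'\<close> to \<open>a1\<close>, and the
  rest of \<open>B\<close> to \<open>a2\<close>.\<close>

lemma distance_graph_2_complement_split_graph:
  assumes "A \<noteq> {a1}"
  shows "distance_graph 2 (complement split_graph) = split_graph"
proof (rule ugraph_eqI)
  let ?F = split_graph
  obtain a b' b'' where a: "a \<in> A" "a \<noteq> a1" and b': "b' \<in> B'" and b'': "b'' \<in> B" "b'' \<notin> B'"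
    using assms a1 B' by blast
  fix u v assume u: "u \<in> verts (distance_graph 2 (complement ?F))"
    and v: "v \<in> verts (distance_graph 2 (complement ?F))" and "u \<noteq> v"
  define g where "g x y \<longleftrightarrow> {x, y} \<in> edges (complement ?F)" for x y
  note g = g_def complement_edge_iff split_graph_edge_iff verts_split_graph
  have gsym: "g x y \<Longrightarrow> g y x" for x y
    by (simp add: g_def insert_commute)
  have A1: "g x a1" if "x \<in> A" "x \<noteq> a1" for x
    unfolding g using that disj a1 a2 B' by blast
  have A2: "g x a2" if "x \<in> A" "x \<noteq> a1" for x
    unfolding g using that disj a1 a2 B' by blast
  have B1: "g x a1" if "x \<in> B'" for x
    unfolding g using that disj a1 a2 B' by blast
  have B2: "g x a2" if "x \<in> B" "x \<notin> B'" for x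
    unfolding g using that disj a1 a2 B' by blast
  have BB: "g x y" if "x \<in> B" "y \<in> B" "x \<noteq> y" for x y
    unfolding g using that disj a1 a2 B' by blast
  \<comment> \<open>For \<open>x = a1\<close> the vertex \<open>y\<close> lies outside
    \<open>B'\<close>, and \<open>b'\<close> serves; otherwise \<open>a1\<close> or
    \<open>a2\<close> serves, according to whether \<open>y\<close> is in \<open>B'\<close>.\<close>
  have cross: "\<exists>w. g x w \<and> g y w" if "x \<in> A" "y \<in> B" "\<not> (x = a1 \<and> y \<in> B')" for x y
  proof (cases "x = a1")
    case True
    then have "g x b'" "g y b'"
      using that gsym[OF B1[OF b']] BB[of y b'] b' B' by auto
    then show ?thesis
      by blast
  next
    case False
    then show ?thesis
      using that A1[of x] A2[of x] B1[of y] B2[of y] by blast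
  qed
  \<comment> \<open>The edge from \<open>a2\<close> to \<open>a1\<close> uses a further vertex
    \<open>a\<close> of \<open>A\<close>; an edge from \<open>a2\<close> to \<open>B'\<close> uses
    \<open>b''\<close>.\<close>
  have star: "\<exists>w. g a2 w \<and> g x w" if x: "x = a1 \<or> x \<in> B'" for x
  proof (cases "x = a1")
    case True
    then show ?thesis
      using A1[OF a] A2[OF a] gsym by blast
  next
    case False
    then have "g a2 b''" "g x b''"
      using x gsym[OF B2[OF b'']] BB[of x b''] b'' B' by auto
    then show ?thesis
      by blast
  qed
  have "\<exists>w. {u, w} \<in> edges (complement ?F) \<and> {w, v} \<in> edges (complement ?F)"
    if uv: "{u, v} \<in> edges ?F"
  proof -
    have "\<exists>w. g u w \<and> g v w"
      using uv[unfolded split_graph_edge_iff] cross[of u v] cross[of v u] star[of u] star[of v]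
      by blast
    then show ?thesis
      using gsym by (auto simp: g_def)
  qed
  then show "{u, v} \<in> edges (distance_graph 2 (complement ?F)) \<longleftrightarrow> {u, v} \<in> edges ?F"
    using u v \<open>u \<noteq> v\<close> distance_graph_2_edge_iff[of "complement ?F" u v] complement_edges_subset[of ?F]
    by (auto simp: complement_edge_iff)
qed (use distance_graph_edges_subset[of 2 "complement split_graph"] split_graph_edges_subset in auto)

text \<open>Two vertices with a common \<open>G\<close>-neighbour that are not adjacent in
  \<open>split_graph\<close> are adjacent in \<open>G\<close> (fact \<open>close\<close>). So it
  suffices to find common \<open>G\<close>-neighbours for the non-edges, and the edges of
  \<open>split_graph\<close> force enough of them.\<close>

lemma eq_complement_split_graph:
  fixes G :: "'a ugraph"
  assumes G: "simple_graph G" and D: "distance_graph 2 G = split_graph" and "A \<noteq> {a1}"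
  shows "G = complement split_graph"
proof (rule ugraph_eqI)
  have V: "verts G = insert a2 (A \<union> B)"
    using D verts_split_graph by (metis verts_distance_graph)
  then show "verts G = verts (complement split_graph)"
    by (simp add: verts_split_graph)
  show GV: "edges G \<subseteq> all_pairs (verts G)"
    using G by (simp add: simple_graph_def)
  show "edges (complement split_graph) \<subseteq> all_pairs (verts (complement split_graph))"
    using complement_edges_subset by simp
  define g where "g u v \<longleftrightarrow> {u, v} \<in> edges G" for u v
  define r where "r u v \<longleftrightarrow> {u, v} \<in> edges split_graph" for u v
  have gsym: "g u v \<longleftrightarrow> g v u" for u v
    by (simp add: g_def insert_commute)
  have gV: "w \<in> insert a2 (A \<union> B)" if "g u w" for u w
    using that edge_in_verts[OF GV] V by (auto simp: g_def)
  have iff: "r u v \<longleftrightarrow> u \<noteq> v \<and> \<not> g u v \<and> (\<exists>w. g u w \<and> g w v)" for u v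
    using distance_graph_2_edge_iff[OF GV] D by (simp add: r_def g_def)
  have common: "\<exists>w. g u w \<and> g w v \<and> \<not> r u w \<and> \<not> r w v \<and> w \<noteq> u \<and> w \<noteq> v \<and> w \<in> insert a2 (A \<union> B)"
    if "r u v" for u v
    using that iff gV by metis
  have close: "g u v" if "g u w" "g v w" "u \<noteq> v" "\<not> r u v" for u v w
    using that iff gsym by blast
  note r = r_def split_graph_edge_iff
  obtain a0 b' b'' where a0: "a0 \<in> A" "a0 \<noteq> a1" and b': "b' \<in> B'" and b'': "b'' \<in> B" "b'' \<notin> B'"
    using assms a1 B' by blast
  txt \<open>For an edge between \<open>A - {a1}\<close> and \<open>B\<close> the only vertex available as a common
    \<open>G\<close>-neighbour is \<open>a1\<close> or \<open>a2\<close>; these forced edges make all other non-edges have distance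
    at most 2.\<close>
  have via1: "g a a1 \<and> g b a1" if "a \<in> A" "a \<noteq> a1" "b \<in> B'" for a b
  proof -
    have "r a b"
      using that B' by (auto simp: r)
    from common[OF this] obtain w where "g a w" "g w b" "\<not> r a w" "\<not> r w b" "w \<in> insert a2 (A \<union> B)"
      by blast
    \<comment> \<open>In \<open>split_graph\<close>, the other vertices of \<open>A\<close> and
      \<open>a2\<close> are adjacent to \<open>b\<close>, and all vertices of \<open>B\<close> are
      adjacent to \<open>a\<close>.\<close>
    moreover from this have "w = a1"
      using that disj a1 B' a2 by (auto simp: r)
    ultimately show ?thesis
      using gsym by blast
  qed
  have via2: "g a a2 \<and> g b a2" if "a \<in> A" "a \<noteq> a1" "b \<in> B" "b \<notin> B'" for a b
  proof -
    have "r a b"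
      using that by (auto simp: r)
    from common[OF this] obtain w where "g a w" "g w b" "\<not> r a w" "\<not> r w b" "w \<in> insert a2 (A \<union> B)"
      by blast
    moreover from this have "w = a2"
      using that disj a1 B' a2 by (auto simp: r)
    ultimately show ?thesis
      using gsym by blast
  qed
  have AA: "g u v" if "u \<in> A" "v \<in> A" "u \<noteq> v" for u v
  proof (cases "u = a1 \<or> v = a1")
    case True
    then show ?thesis
      using that via1 b' gsym by blast
  next
    case False
    then show ?thesis
      using that via1[OF _ _ b'] close[of u a1 v] disj a2 by (auto simp: r)
  qed
  have BB': "g u v" if "u \<in> B'" "v \<in> B'" "u \<noteq> v" for u v
    using that via1[OF a0] close[of u a1 v] disj a2 B' by (auto simp: r)
  have BB'': "g u v" if "u \<in> B" "u \<notin> B'" "v \<in> B" "v \<notin> B'" "u \<noteq> v" for u v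
    using that via2[OF a0] close[of u a2 v] disj a2 by (auto simp: r)
  \<comment> \<open>The edge \<open>a1 u\<close> only forces some common neighbour \<open>w\<close>
    in \<open>B'\<close>. If \<open>v\<close> is not \<open>w\<close> itself, \<open>BB'\<close>
    joins it to \<open>w\<close>, so \<open>u\<close> and \<open>v\<close> share the
    \<open>G\<close>-neighbour \<open>w\<close>.\<close>
  have BB: "g u v" if "u \<in> B" "u \<notin> B'" "v \<in> B'" for u v
  proof -
    have "r a1 u"
      using that a1 by (auto simp: r)
    from common[OF this] obtain w where w: "g a1 w" "g w u" "\<not> r a1 w" "\<not> r w u" "w \<noteq> a1"
        "w \<in> insert a2 (A \<union> B)"
      by blast
    then have "w \<in> B'"
      using that disj a1 B' a2 by (auto simp: r)
    then show ?thesis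
      using that w(2) BB'[of v w] close[of u w v] gsym disj a2 B' by (cases "w = v") (auto simp: r)
  qed
  have nonadj: "g u v" if "u \<in> insert a2 (A \<union> B)" "v \<in> insert a2 (A \<union> B)" "u \<noteq> v" "\<not> r u v" for u v
  proof -
    have a2A: "g a a2" if "a \<in> A" "a \<noteq> a1" for a
      using that via2 b'' by blast
    have a2B: "g b a2" if "b \<in> B" "b \<notin> B'" for b
      using that via2 a0 by blast
    have a1B: "g b a1" if "b \<in> B'" for b
      using that via1 a0 by blast
    have "g u v \<or> g v u"
      using that(1-3) that(4)[unfolded r] AA[of u v] BB'[of u v] BB''[of u v] BB[of u v] BB[of v u]
        a2A[of u] a2A[of v] a2B[of u] a2B[of v] a1B[of u] a1B[of v] B'
      by (elim insertE UnE) auto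
    then show ?thesis
      using gsym by blast
  qed
  show "{u, v} \<in> edges G \<longleftrightarrow> {u, v} \<in> edges (complement split_graph)"
    if "u \<in> verts G" "v \<in> verts G" "u \<noteq> v" for u v
  proof -
    have "g u v \<longleftrightarrow> \<not> r u v"
      using that nonadj[of u v] iff[of u v] V by blast
    then show ?thesis
      using that V by (simp add: complement_edge_iff verts_split_graph g_def r_def)
  qed
qed

end

text \<open>Balance is expressed through the sum and product of the class sizes, the form that edge
  counting delivers and that is symmetric in \<open>A\<close> and \<open>B\<close>.\<close>

lemma split_turan_iff:
  "F \<in> split_turan n \<longleftrightarrow> (\<exists>A B a1 B' a2. split_config A B a1 B' a2 \<and>
     card A + card B = n - 1 \<and> card A * card B = (n - 1)\<^sup>2 div 4 \<and>
     F = split_config.split_graph A B a1 B' a2)"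
proof
  assume "F \<in> split_turan n"
  then obtain A B a1 B' B'' a2 where F: "F = split_vertex (complete_bipartite A B) a1 B' a2"
    and fin: "finite A" "finite B" "A \<inter> B = {}"
    and card: "card A = (n - 1) div 2 \<and> card B = (n - 1 + 1) div 2 \<or>
      card A = (n - 1 + 1) div 2 \<and> card B = (n - 1) div 2"
    and "a1 \<in> A" "B = B' \<union> B''" "B' \<inter> B'' = {}" "B' \<noteq> {}" "B'' \<noteq> {}"
    and "a2 \<notin> verts (complete_bipartite A B)"
    unfolding split_turan_def turan2_def by blast
  then have c: "split_config A B a1 B' a2"
    by unfold_locales (auto simp: complete_bipartite_def)
  have sum: "card A + card B = n - 1"
    using card by linarith
  show "\<exists>A B a1 B' a2. split_config A B a1 B' a2 \<and>
     card A + card B = n - 1 \<and> card A * card B = (n - 1)\<^sup>2 div 4 \<and>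
     F = split_config.split_graph A B a1 B' a2"
    using c sum card balanced_iff_mult_eq[OF sum] F split_config.split_graph_def[OF c]
    by (intro exI conjI) auto
next
  assume "\<exists>A B a1 B' a2. split_config A B a1 B' a2 \<and>
     card A + card B = n - 1 \<and> card A * card B = (n - 1)\<^sup>2 div 4 \<and>
     F = split_config.split_graph A B a1 B' a2"
  then obtain A B a1 B' a2 where c: "split_config A B a1 B' a2"
    and sum: "card A + card B = n - 1" and prod: "card A * card B = (n - 1)\<^sup>2 div 4"
    and F: "F = split_config.split_graph A B a1 B' a2"
    by blast
  interpret split_config A B a1 B' a2
    by (rule c)
  have "turan2 (n - 1) A B (complete_bipartite A B)"
    unfolding turan2_def using fin disj balanced_iff_mult_eq[OF sum] prod by simp
  moreover have "B = B' \<union> (B - B')" "B' \<inter> (B - B') = {}" "B - B' \<noteq> {}"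
    using B' by auto
  moreover have "a2 \<notin> verts (complete_bipartite A B)"
    using a2 by (simp add: complete_bipartite_def)
  ultimately show "F \<in> split_turan n"
    unfolding split_turan_def F split_graph_def using a1 B'(2) by blast
qed

section \<open>The extremal problem\<close>

text \<open>Recognition by adjacencies: \<open>z\<close> plays \<open>a2\<close>, and
  \<open>B'\<close> consists of its neighbours in \<open>B\<close>; \<open>b'\<close> and
  \<open>b''\<close> witness that the partition is non-trivial. The form allows an application with
  the classes exchanged.\<close>

lemma in_split_turanI:
  fixes F :: "'a ugraph"
  assumes F: "edges F \<subseteq> all_pairs (verts F)" and V: "verts F = insert z (A \<union> B)"
    and fin: "finite A" "finite B" and disj: "A \<inter> B = {}" and z: "z \<notin> A" "z \<notin> B"
    and size: "card A + card B = n - 1" "card A * card B = (n - 1)\<^sup>2 div 4"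
    and indA: "\<And>u v. u \<in> A \<Longrightarrow> v \<in> A \<Longrightarrow> {u, v} \<notin> edges F"
    and indB: "\<And>u v. u \<in> B \<Longrightarrow> v \<in> B \<Longrightarrow> {u, v} \<notin> edges F"
    and a1: "a1 \<in> A" and za: "\<And>a. a \<in> A \<Longrightarrow> {z, a} \<in> edges F \<longleftrightarrow> a = a1"
    and b': "b' \<in> B" "{z, b'} \<in> edges F" and b'': "b'' \<in> B" "{z, b''} \<notin> edges F"
    and ab: "\<And>a b. a \<in> A \<Longrightarrow> b \<in> B \<Longrightarrow> {a, b} \<in> edges F \<longleftrightarrow> \<not> (a = a1 \<and> {z, b} \<in> edges F)"
  shows "F \<in> split_turan n"
proof -
  define B' where "B' = {b\<in>B. {z, b} \<in> edges F}"
  interpret split_config A B a1 B' z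
    by unfold_locales (use fin disj a1 b' b'' z in \<open>auto simp: B'_def\<close>)
  define r where "r u v \<longleftrightarrow> {u, v} \<in> edges F" for u v
  define s where "s u v \<longleftrightarrow> {u, v} \<in> edges split_graph" for u v
  have sym: "r u v \<longleftrightarrow> r v u" "s u v \<longleftrightarrow> s v u" for u v
    by (simp_all add: r_def s_def insert_commute)
  have s: "s u v \<longleftrightarrow>
    u \<in> A \<and> v \<in> B \<and> \<not> (u = a1 \<and> r z v) \<or> v \<in> A \<and> u \<in> B \<and> \<not> (v = a1 \<and> r z u) \<or>
    u = z \<and> (v = a1 \<or> v \<in> B \<and> r z v) \<or> v = z \<and> (u = a1 \<or> u \<in> B \<and> r z u)" for u v
    unfolding s_def split_graph_edge_iff by (auto simp: B'_def r_def)
  have at_z: "r z v \<longleftrightarrow> s z v" if "v \<in> A \<union> B" for v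
    using that za[of v] a1 disj z by (auto simp: s r_def)
  have inA: "r u v \<longleftrightarrow> s u v" if "u \<in> A" "v \<in> A" for u v
    using that indA[of u v] disj z by (auto simp: s r_def)
  have inB: "r u v \<longleftrightarrow> s u v" if "u \<in> B" "v \<in> B" for u v
    using that indB[of u v] disj z by (auto simp: s r_def)
  have inAB: "r u v \<longleftrightarrow> s u v" if "u \<in> A" "v \<in> B" for u v
    using that ab[of u v] disj z by (auto simp: s r_def)
  have "F = split_graph"
  proof (rule ugraph_eqI)
    show "verts F = verts split_graph"
      by (simp add: V verts_split_graph)
    show "{u, v} \<in> edges F \<longleftrightarrow> {u, v} \<in> edges split_graph"
      if "u \<in> verts F" "v \<in> verts F" "u \<noteq> v" for u v
    proof -
      have "r u v \<longleftrightarrow> s u v"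
        using that at_z[of u] at_z[of v] inA[of u v] inB[of u v] inAB[of u v] inAB[of v u]
          sym[of u v] unfolding V by (elim insertE UnE) auto
      then show ?thesis
        by (simp add: r_def s_def)
    qed
  qed (use F split_graph_edges_subset in auto)
  then show ?thesis
    unfolding split_turan_iff using size split_config_axioms by blast
qed

lemma distance_graph_2_in_split_turan:
  fixes G :: "'a ugraph"
  assumes G: "simple_graph G"
    and tri: "\<And>u v w. {u, v} \<in> edges (distance_graph 2 G) \<Longrightarrow>
      {v, w} \<in> edges (distance_graph 2 G) \<Longrightarrow> {u, w} \<notin> edges (distance_graph 2 G)"
    and large: "(card (verts G) - 1)\<^sup>2 div 4 < card (edges (distance_graph 2 G))"
  shows "distance_graph 2 G \<in> split_turan (card (verts G))"
proof -
  define V E n where "V = verts G" and "E = edges (distance_graph 2 G)" and "n = card V"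
  define N where "N u = {w. {u, w} \<in> E}" for u
  have fin: "finite V" and EV: "E \<subseteq> all_pairs V"
    using G distance_graph_edges_subset[of 2 G] by (auto simp: simple_graph_def V_def E_def)
  have finE: "finite E"
    using EV fin finite_all_pairs finite_subset by blast
  have sym: "{u, v} \<in> E \<longleftrightarrow> {v, u} \<in> E" for u v
    by (simp add: insert_commute)
  have large: "(n - 1)\<^sup>2 div 4 < card E"
    using large by (simp add: n_def V_def E_def)
  have "\<exists>x y. {x, y} \<in> E \<and> n - 1 \<le> card (N x) + card (N y)"
  proof (rule ccontr)
    assume "\<not> ?thesis"
    \<comment> \<open>If all degree sums were at most n - 2, then 4|E| <= n(n - 2) = (n - 1)^2 - 1
      for n >= 2, too few edges.\<close>
    then have "card (N x) + card (N y) \<le> n - 2" if "{x, y} \<in> E" for x y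
      using that by force
    then have "4 * card E \<le> n * (n - 2)"
      unfolding n_def N_def by (rule card_edges_le_of_degree_sums[OF fin EV])
    also have "\<dots> \<le> (n - 1)\<^sup>2"
    proof (cases "n < 2")
      case False
      then obtain k where "n = k + 2"
        by (metis add.commute le_Suc_ex not_less)
      then show ?thesis
        by (simp add: power2_eq_square)
    qed simp
    finally show False
      using large by linarith
  qed
  then obtain x y where xy: "{x, y} \<in> E" and deg: "n - 1 \<le> card (N x) + card (N y)"
    by blast
  define A B where "A = N y" and "B = N x"
  have tri: "{u, v} \<in> E \<Longrightarrow> {v, w} \<in> E \<Longrightarrow> {u, w} \<notin> E" for u v w
    using tri by (simp add: E_def)
  have xA: "x \<in> A" and yB: "y \<in> B"
    using xy sym by (auto simp: A_def B_def N_def)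
  have disj: "A \<inter> B = {}"
    using tri[of x _ y] xy sym by (auto simp: A_def B_def N_def)
  have indA: "{u, v} \<notin> E" if "u \<in> A" "v \<in> A" for u v
    using tri[of u y v] that sym by (auto simp: A_def N_def)
  have indB: "{u, v} \<notin> E" if "u \<in> B" "v \<in> B" for u v
    using tri[of u x v] that sym by (auto simp: B_def N_def)
  have ABV: "A \<subseteq> V" "B \<subseteq> V"
    using edge_in_verts[OF EV] by (auto simp: A_def B_def N_def)
  then have finAB: "finite A" "finite B"
    using fin finite_subset by blast+
  have cAB: "card (A \<union> B) = card A + card B"
    using finAB disj by (simp add: card_Un_disjoint)
  have not_bipartite: False
    if "V = X \<union> Y" "X \<inter> Y = {}" "\<And>u v. {u, v} \<in> E \<Longrightarrow> u \<in> X \<and> v \<in> Y \<or> u \<in> Y \<and> v \<in> X" for X Y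
    using card_distance_graph_2_bipartite_le[OF G, of X Y] that large
    unfolding V_def E_def n_def by (meson leD)
  have "V \<noteq> A \<union> B"
    using not_bipartite[of A B] disj indA indB edge_in_verts[OF EV] by blast
  then obtain z where z: "z \<in> V" "z \<notin> A" "z \<notin> B"
    using ABV by blast
  have sub: "insert z (A \<union> B) \<subseteq> V"
    using z ABV by blast
  have czAB: "card (insert z (A \<union> B)) = card A + card B + 1"
    using z finAB cAB by simp
  have "card (insert z (A \<union> B)) \<le> n"
    unfolding n_def using sub fin by (rule card_mono[rotated])
  \<comment> \<open>The degree sum gives |A| + |B| >= n - 1, while \<open>z\<close> lies outside
    both sets, so equality holds and \<open>z\<close> is the only vertex left over.\<close>
  then have sum: "card A + card B = n - 1" and "card (insert z (A \<union> B)) = card V"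
    using deg czAB by (auto simp: A_def B_def n_def)
  then have V: "V = insert z (A \<union> B)"
    using sub fin card_subset_eq by metis
  have zz: "{z, z} \<notin> E"
    using edge_in_verts[OF EV] by blast
  define S T where "S = {a\<in>A. {z, a} \<in> E}" and "T = {b\<in>B. {z, b} \<in> E}"
  have finST: "finite S" "finite T" and ST: "S \<subseteq> A" "T \<subseteq> B"
    using finAB by (auto simp: S_def T_def)
  have cover: "(u = z \<or> u \<in> A \<or> u \<in> B) \<and> (v = z \<or> v \<in> A \<or> v \<in> B)" if "{u, v} \<in> E" for u v
    using edge_in_verts[OF EV that] V by blast
  \<comment> \<open>Without neighbours in \<open>A\<close>, the vertex \<open>z\<close> could join
    that class, making the graph bipartite; likewise for \<open>T\<close> and
    \<open>B\<close>.\<close>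
  have "S \<noteq> {}"
  proof
    assume "S = {}"
    then have "{z, a} \<notin> E \<and> {a, z} \<notin> E" if "a \<in> A" for a
      using that sym by (auto simp: S_def)
    then show False
      using not_bipartite[of "insert z A" B] V disj z indA indB zz cover by blast
  qed
  have "T \<noteq> {}"
  proof
    assume "T = {}"
    then have "{z, b} \<notin> E \<and> {b, z} \<notin> E" if "b \<in> B" for b
      using that sym by (auto simp: T_def)
    then show False
      using not_bipartite[of A "insert z B"] V disj z indA indB zz cover by blast
  qed
  define E0 E1 P where "E0 = {e\<in>E. z \<notin> e}" and "E1 = (\<lambda>v. {z, v}) ` (S \<union> T)"
    and "P = {(a, b). a \<in> A \<and> b \<in> B \<and> {a, b} \<in> E0}"
  have "e \<in> E0 \<union> E1" if e: "e \<in> E" for e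
  proof (cases "z \<in> e")
    case True
    then obtain v where v: "e = {z, v}"
      using e EV by (blast elim: all_pairs_elim)
    then have "v \<in> S \<union> T"
      using e cover[of z v] zz by (auto simp: S_def T_def)
    then show ?thesis
      using v by (auto simp: E1_def)
  qed (use e in \<open>simp add: E0_def\<close>)
  then have E: "E = E0 \<union> E1"
    by (auto simp: E0_def E1_def S_def T_def)
  have c1: "card E1 = card S + card T"
  proof -
    have "card E1 = card (S \<union> T)"
      unfolding E1_def by (rule card_image) (auto simp: inj_on_def doubleton_eq_iff)
    then show ?thesis
      using finST ST disj by (subst (asm) card_Un_disjoint) auto
  qed
  have c0: "card E0 = card P"
    unfolding P_def
  proof (rule card_bipartite_edges[OF disj])
    fix e assume e: "e \<in> E0"
    then have "e \<in> all_pairs V"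
      using EV by (auto simp: E0_def)
    then obtain u v where "e = {u, v}"
      by (rule all_pairs_elim)
    then show "\<exists>x\<in>A. \<exists>y\<in>B. e = {x, y}"
      using e cover[of u v] indA[of u v] indB[of u v] by (auto simp: E0_def insert_commute)
  qed
  have "finite E0" "finite E1" "E0 \<inter> E1 = {}"
    using finE finST by (auto simp: E0_def E1_def)
  then have "card E = card E0 + card E1"
    by (simp add: E card_Un_disjoint)
  then have cE: "card E = card P + card S + card T"
    using c0 c1 by simp
  \<comment> \<open>An edge between \<open>S\<close> and \<open>T\<close> would close a triangle
    with \<open>z\<close>.\<close>
  have Psub: "P \<subseteq> A \<times> B - S \<times> T"
  proof
    fix p assume "p \<in> P"
    then obtain a b where p: "p = (a, b)" "a \<in> A" "b \<in> B" "{a, b} \<in> E"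
      by (auto simp: P_def E0_def)
    then show "p \<in> A \<times> B - S \<times> T"
      using tri[of z a b] by (auto simp: S_def T_def)
  qed
  have cdiff: "card (A \<times> B - S \<times> T) = card A * card B - card S * card T"
    using finST ST by (subst card_Diff_subset) (auto simp: card_cartesian_product)
  have cP: "card P \<le> card A * card B - card S * card T"
    unfolding cdiff[symmetric] using Psub finAB by (intro card_mono) auto
  have stab: "card S * card T \<le> card A * card B"
    using ST finAB by (intro mult_le_mono card_mono)
  have quarter: "card A * card B \<le> (n - 1)\<^sup>2 div 4"
    using mult_le_quarter_square[of "card A" "card B"] sum by simp
  \<comment> \<open>Here \<open>s\<close> and \<open>t\<close> are one less than the numbers of
    neighbours of \<open>z\<close> in \<open>A\<close> and \<open>B\<close>. The count becomes |E|
    <= |A||B| + 1 - st, so exceeding the bound forces st = 0 and equality throughout.\<close>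
  obtain s t where st: "card S = Suc s" "card T = Suc t"
    using finST \<open>S \<noteq> {}\<close> \<open>T \<noteq> {}\<close> by (metis card_eq_0_iff not0_implies_Suc)
  have "card S * card T = s * t + s + t + 1"
    by (simp add: st)
  then have "s * t = 0" and prod: "card A * card B = (n - 1)\<^sup>2 div 4"
    and "card P = card A * card B - card S * card T"
    using cE cP stab quarter large st by linarith+
  then have P: "P = A \<times> B - S \<times> T"
    using Psub finAB cdiff by (intro card_subset_eq) auto
  have AB: "{a, b} \<in> E \<longleftrightarrow> \<not> ({z, a} \<in> E \<and> {z, b} \<in> E)" if "a \<in> A" "b \<in> B" for a b
  proof -
    have "{a, b} \<in> E \<longleftrightarrow> (a, b) \<in> P"
      using that z by (auto simp: P_def E0_def)
    then show ?thesis
      using that by (auto simp: P S_def T_def)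
  qed
  have VF: "edges (distance_graph 2 G) \<subseteq> all_pairs (verts (distance_graph 2 G))"
    "verts (distance_graph 2 G) = insert z (A \<union> B)"
    using distance_graph_edges_subset[of 2 G] V by (auto simp: V_def)
  \<comment> \<open>As \<open>z\<close> lies in neither neighbourhood, \<open>y\<close> in
    \<open>B\<close> and \<open>x\<close> in \<open>A\<close> are non-neighbours of
    \<open>z\<close>; they witness the non-trivial partition in the two cases below.\<close>
  have zx: "{z, x} \<notin> E" and zy: "{z, y} \<notin> E"
    using z sym by (auto simp: A_def B_def N_def)
  show ?thesis
  proof (cases "s = 0")
    case True
    then obtain a1 where a1: "S = {a1}"
      using st by (auto simp: card_1_singleton_iff)
    obtain b' where b': "b' \<in> B" "{z, b'} \<in> E"
      using \<open>T \<noteq> {}\<close> by (auto simp: T_def)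
    have za: "{z, a} \<in> E \<longleftrightarrow> a = a1" if "a \<in> A" for a
      using a1 that by (auto simp: S_def)
    show ?thesis
      unfolding V_def[symmetric] n_def[symmetric]
      by (rule in_split_turanI[OF VF finAB disj z(2,3) sum prod, where b' = b' and b'' = y and ?a1.0 = a1],
          unfold E_def[symmetric])
        (use indA indB a1 za b' yB zy AB in \<open>auto simp: S_def\<close>)
  next
    case False
    then have "t = 0"
      using \<open>s * t = 0\<close> by simp
    then obtain b1 where b1: "T = {b1}"
      using st by (auto simp: card_1_singleton_iff)
    obtain a' where a': "a' \<in> A" "{z, a'} \<in> E"
      using \<open>S \<noteq> {}\<close> by (auto simp: S_def)
    have zb: "{z, b} \<in> E \<longleftrightarrow> b = b1" if "b \<in> B" for b
      using b1 that by (auto simp: T_def)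
    \<comment> \<open>Now \<open>b1\<close> plays the role of \<open>a1\<close>, so the two classes
      are exchanged.\<close>
    have BA: "{b, a} \<in> E \<longleftrightarrow> \<not> (b = b1 \<and> {z, a} \<in> E)" if "b \<in> B" "a \<in> A" for a b
      using AB[of a b] that zb sym by blast
    have VF': "verts (distance_graph 2 G) = insert z (B \<union> A)"
      using VF by blast
    have size: "card B + card A = n - 1" "card B * card A = (n - 1)\<^sup>2 div 4" "B \<inter> A = {}"
      using sum prod disj by (auto simp: add.commute mult.commute)
    show ?thesis
      unfolding V_def[symmetric] n_def[symmetric]
      by (rule in_split_turanI[OF VF(1) VF' finAB(2,1) size(3) z(3,2) size(1,2),
            where b' = a' and b'' = x and ?a1.0 = b1],
          unfold E_def[symmetric])
        (use indA indB b1 zb a' xA zx BA in \<open>auto simp: T_def\<close>)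
  qed
qed

section \<open>Properties of split Turan graphs and their transport between vertex types\<close>

lemma split_turan_properties:
  fixes F :: "'a ugraph"
  assumes "F \<in> split_turan n" "n \<ge> 5"
  shows "card (verts F) = n" "card (edges F) = (n - 1)\<^sup>2 div 4 + 1"
    "finite (verts F)" "edges F \<subseteq> all_pairs (verts F)"
    "\<not> contains_copy F (complete_graph 3)"
    "distance_graph 2 (complement F) = F"
    "\<And>G. simple_graph G \<Longrightarrow> distance_graph 2 G = F \<Longrightarrow> G = complement F"
proof -
  obtain A B a1 B' a2 where c: "split_config A B a1 B' a2"
    and sum: "card A + card B = n - 1" and prod: "card A * card B = (n - 1)\<^sup>2 div 4"
    and F: "F = split_config.split_graph A B a1 B' a2"
    using assms(1) unfolding split_turan_iff by blast
  interpret split_config A B a1 B' a2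
    by (rule c)
  \<comment> \<open>For \<open>n \<ge> 5\<close> both classes have at least two vertices, so
    \<open>A\<close> has one besides \<open>a1\<close>, the side condition of the two distance
    results.\<close>
  have "2 \<le> (n - 1) div 2"
    using assms(2) by linarith
  then have "2 \<le> card A"
    using balanced_iff_mult_eq[OF sum] prod by linarith
  then have A: "A \<noteq> {a1}"
    by auto
  show "card (verts F) = n"
    using card_verts_split_graph sum assms(2) by (simp add: F)
  show "card (edges F) = (n - 1)\<^sup>2 div 4 + 1"
    using card_edges_split_graph prod by (simp add: F)
  show "finite (verts F)"
    using fin by (simp add: F verts_split_graph)
  show "edges F \<subseteq> all_pairs (verts F)"
    using split_graph_edges_subset by (simp add: F)
  show "\<not> contains_copy F (complete_graph 3)"
    unfolding F contains_triangle_iff[OF split_graph_edges_subset] using split_graph_triangle_free by blast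
  show "distance_graph 2 (complement F) = F"
    using distance_graph_2_complement_split_graph[OF A] by (simp add: F)
  show "G = complement F" if "simple_graph G" "distance_graph 2 G = F" for G
    using eq_complement_split_graph[OF _ _ A] that by (simp add: F)
qed

text \<open>The construction commutes with injective relabelling. This links graphs on an arbitrary
  type with the representatives on the natural numbers.\<close>

lemma split_turan_image:
  assumes "F \<in> split_turan n" and inj: "inj_on f (verts F)"
  obtains F' where "F' \<in> split_turan n" "verts F' = f ` verts F"
    "\<And>u v. u \<in> verts F \<Longrightarrow> v \<in> verts F \<Longrightarrow> {f u, f v} \<in> edges F' \<longleftrightarrow> {u, v} \<in> edges F"
proof -
  obtain A B a1 B' a2 where c: "split_config A B a1 B' a2"
    and size: "card A + card B = n - 1" "card A * card B = (n - 1)\<^sup>2 div 4"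
    and F: "F = split_config.split_graph A B a1 B' a2"
    using assms(1) unfolding split_turan_iff by blast
  interpret split_config A B a1 B' a2
    by (rule c)
  have V: "verts F = insert a2 (A \<union> B)"
    by (simp add: F verts_split_graph)
  have eq: "f u = f v \<longleftrightarrow> u = v" if "u \<in> verts F" "v \<in> verts F" for u v
    using inj that by (auto dest: inj_onD)
  have mem: "f u \<in> f ` X \<longleftrightarrow> u \<in> X" if "u \<in> verts F" "X \<subseteq> verts F" for u X
    using inj that by (auto dest: inj_onD)
  have sub: "A \<subseteq> verts F" "B \<subseteq> verts F" "B' \<subseteq> verts F" "a1 \<in> verts F" "a2 \<in> verts F"
    using V a1 B' by auto
  have c': "split_config (f ` A) (f ` B) (f a1) (f ` B') (f a2)"
  proof
    show "f ` A \<inter> f ` B = {}"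
      using inj_on_image_Int[OF inj sub(1,2)] disj by simp
    show "f ` B' \<noteq> f ` B"
      using inj_on_image_eq_iff[OF inj sub(3,2)] B' by simp
    show "f a2 \<notin> f ` A" "f a2 \<notin> f ` B"
      using mem sub a2 by blast+
  qed (use fin a1 B' in auto)
  interpret im: split_config "f ` A" "f ` B" "f a1" "f ` B'" "f a2"
    by (rule c')
  have card: "card (f ` A) = card A" "card (f ` B) = card B"
    using inj sub by (auto intro: card_image inj_on_subset)
  show thesis
  proof (rule that)
    show "im.split_graph \<in> split_turan n"
      unfolding split_turan_iff using c' size card by metis
    show "verts im.split_graph = f ` verts F"
      by (simp add: im.verts_split_graph V image_Un)
    show "{f u, f v} \<in> edges im.split_graph \<longleftrightarrow> {u, v} \<in> edges F"
      if "u \<in> verts F" "v \<in> verts F" for u v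
      using that sub unfolding im.split_graph_edge_iff F split_graph_edge_iff
      by (simp add: F[symmetric] eq mem)
  qed
qed

section \<open>The extremal number and the extremal graphs\<close>

lemma split_turan_nonempty:
  assumes "n \<ge> 5"
  shows "split_turan n \<noteq> ({} :: nat ugraph set)"
proof -
  define k where "k = (n - 1) div 2"
  have k: "2 \<le> k" "k + 2 \<le> n - 1" and half: "n - 1 - k = (n - 1 + 1) div 2"
    using assms unfolding k_def by linarith+
  \<comment> \<open>The classes are 0, ..., k - 1 and k, ..., n - 2, with \<open>a2 = n - 1\<close>;
    \<open>B'\<close> is the single vertex \<open>k\<close>, and \<open>k + 1\<close> remains for
    \<open>B''\<close>.\<close>
  have c: "split_config {..<k} {k..<n - 1} 0 {k} (n - 1)"
  proof
    have "Suc k \<in> {k..<n - 1}" "Suc k \<notin> {k}"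
      using k by auto
    then show "{k} \<noteq> {k..<n - 1}"
      by metis
  qed (use k in auto)
  have sum: "card {..<k} + card {k..<n - 1} = n - 1"
    using k by simp
  have "card {..<k} * card {k..<n - 1} = (n - 1)\<^sup>2 div 4"
    using balanced_iff_mult_eq[OF sum] half by (simp add: k_def)
  then show ?thesis
    using c sum split_turan_iff by blast
qed

text \<open>Any number of edges above the rounded quarter already puts the distance graph into
  \<open>split_turan n\<close>, where the excess is exactly 1.\<close>

lemma admissible_card_le:
  fixes G :: "'a ugraph"
  assumes "n \<ge> 5" and G: "admissible 2 n (complete_graph 3) G"
  shows "card (edges (distance_graph 2 G)) \<le> (n - 1)\<^sup>2 div 4 + 1"
    and "card (edges (distance_graph 2 G)) = (n - 1)\<^sup>2 div 4 + 1 \<Longrightarrow> distance_graph 2 G \<in> split_turan n"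
proof -
  have tri: "{u, v} \<in> edges (distance_graph 2 G) \<Longrightarrow>
      {v, w} \<in> edges (distance_graph 2 G) \<Longrightarrow> {u, w} \<notin> edges (distance_graph 2 G)" for u v w
    using G contains_triangle_iff[of "distance_graph 2 G"] distance_graph_edges_subset[of 2 G]
    by (auto simp: admissible_def)
  have large: "distance_graph 2 G \<in> split_turan n"
    if "(n - 1)\<^sup>2 div 4 < card (edges (distance_graph 2 G))"
    using distance_graph_2_in_split_turan[OF _ tri] that G by (auto simp: admissible_def)
  then show "card (edges (distance_graph 2 G)) \<le> (n - 1)\<^sup>2 div 4 + 1"
    using split_turan_properties(2)[OF _ assms(1)] by fastforce
  show "distance_graph 2 G \<in> split_turan n"
    if "card (edges (distance_graph 2 G)) = (n - 1)\<^sup>2 div 4 + 1"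
    using large that by simp
qed

lemma admissible_complement_split_turan:
  assumes "F \<in> split_turan n" "n \<ge> 5"
  shows "admissible 2 n (complete_graph 3) (complement F)"
    "card (edges (distance_graph 2 (complement F))) = (n - 1)\<^sup>2 div 4 + 1"
  using split_turan_properties[OF assms] complement_edges_subset[of F]
  by (auto simp: admissible_def simple_graph_def)

lemma ex_dist_2_triangle:
  assumes "n \<ge> 5"
  shows "ex_dist 2 n (complete_graph 3) = (n - 1)\<^sup>2 div 4 + 1"
  unfolding ex_dist_def
proof (rule Max_eqI)
  let ?M = "{card (edges (distance_graph 2 G)) | G :: nat ugraph. admissible 2 n (complete_graph 3) G}"
  show le: "m \<le> (n - 1)\<^sup>2 div 4 + 1" if "m \<in> ?M" for m
    using that admissible_card_le(1)[OF assms] by blast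
  show "finite ?M"
    using le finite_nat_set_iff_bounded_le by blast
  obtain F :: "nat ugraph" where "F \<in> split_turan n"
    using split_turan_nonempty[OF assms] by blast
  then show "(n - 1)\<^sup>2 div 4 + 1 \<in> ?M"
    using admissible_complement_split_turan[OF _ assms] by (metis (mono_tags, lifting) mem_Collect_eq)
qed

text \<open>Relabelling along the inverse isomorphism turns a representative on the natural numbers
  into a split Turan graph on the vertices of \<open>G\<close>; conversely a finite vertex set
  embeds into the natural numbers.\<close>

lemma isomorphic_complement_split_turan_iff:
  fixes G :: "'a ugraph"
  assumes G: "simple_graph G" and n: "n \<ge> 5"
  shows "(\<exists>H :: nat ugraph. H \<in> split_turan n \<and> isomorphic G (complement H)) \<longleftrightarrow>
    (\<exists>F \<in> split_turan n. G = complement F)"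
proof
  assume "\<exists>H :: nat ugraph. H \<in> split_turan n \<and> isomorphic G (complement H)"
  then obtain H :: "nat ugraph" and f where H: "H \<in> split_turan n"
    and f: "bij_betw f (verts G) (verts H)"
    and iso: "\<And>u v. u \<in> verts G \<Longrightarrow> v \<in> verts G \<Longrightarrow>
      {u, v} \<in> edges G \<longleftrightarrow> {f u, f v} \<in> edges (complement H)"
    unfolding isomorphic_def by auto
  define h where "h = inv_into (verts G) f"
  have h: "bij_betw h (verts H) (verts G)"
    unfolding h_def using f by (rule bij_betw_inv_into)
  have hf: "h (f u) = u" "f u \<in> verts H" if "u \<in> verts G" for u
    using f that by (auto simp: h_def bij_betw_def)
  obtain F where F: "F \<in> split_turan n" "verts F = h ` verts H"
    and FH: "\<And>u v. u \<in> verts H \<Longrightarrow> v \<in> verts H \<Longrightarrow> {h u, h v} \<in> edges F \<longleftrightarrow> {u, v} \<in> edges H"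
    using split_turan_image[OF H bij_betw_imp_inj_on[OF h]] by metis
  have VF: "verts F = verts G"
    using F h by (simp add: bij_betw_def)
  have "G = complement F"
  proof (rule ugraph_eqI)
    show "{u, v} \<in> edges G \<longleftrightarrow> {u, v} \<in> edges (complement F)"
      if "u \<in> verts G" "v \<in> verts G" "u \<noteq> v" for u v
      using that iso[of u v] FH[of "f u" "f v"] hf VF by (metis complement_edge_iff)
  qed (use G VF complement_edges_subset[of F] in \<open>auto simp: simple_graph_def\<close>)
  then show "\<exists>F \<in> split_turan n. G = complement F"
    using F(1) by blast
next
  assume "\<exists>F \<in> split_turan n. G = complement F"
  then obtain F where F: "F \<in> split_turan n" and GF: "G = complement F"
    by blast
  obtain f :: "'a \<Rightarrow> nat" where f: "inj_on f (verts F)"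
    using finite_imp_inj_to_nat_seg[OF split_turan_properties(3)[OF F n]] by blast
  obtain H where H: "H \<in> split_turan n" "verts H = f ` verts F"
    and FH: "\<And>u v. u \<in> verts F \<Longrightarrow> v \<in> verts F \<Longrightarrow> {f u, f v} \<in> edges H \<longleftrightarrow> {u, v} \<in> edges F"
    using split_turan_image[OF F f] by metis
  have "isomorphic G (complement H)"
    unfolding isomorphic_def
  proof (intro exI conjI ballI)
    show "bij_betw f (verts G) (verts (complement H))"
      using f H by (simp add: GF bij_betw_def)
    show "{u, v} \<in> edges G \<longleftrightarrow> {f u, f v} \<in> edges (complement H)"
      if "u \<in> verts G" "v \<in> verts G" for u v
      using that FH[of u v] f H inj_on_eq_iff[OF f, of u v] by (simp add: GF complement_edge_iff)
  qed
  then show "\<exists>H :: nat ugraph. H \<in> split_turan n \<and> isomorphic G (complement H)"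
    using H by blast
qed

theorem theorem1:
  fixes n :: nat
  assumes "n \<ge> 5"
  shows "int (ex_dist 2 n (complete_graph 3)) = \<lfloor>(real n - 1)\<^sup>2 / 4\<rfloor> + 1 \<and>
    (\<forall>G :: 'a ugraph. simple_graph G \<and> card (verts G) = n \<longrightarrow>
       (extremal 2 n (complete_graph 3) G \<longleftrightarrow>
        (\<exists>H :: nat ugraph. H \<in> split_turan n \<and> isomorphic G (complement H))))"
proof (intro conjI allI impI)
  have "(real n - 1)\<^sup>2 / 4 = real ((n - 1)\<^sup>2) / real 4"
    using assms by (simp add: of_nat_diff)
  then have "\<lfloor>(real n - 1)\<^sup>2 / 4\<rfloor> = int ((n - 1)\<^sup>2 div 4)"
    by (metis floor_divide_of_nat_eq)
  then show "int (ex_dist 2 n (complete_graph 3)) = \<lfloor>(real n - 1)\<^sup>2 / 4\<rfloor> + 1"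
    by (simp add: ex_dist_2_triangle[OF assms])
next
  fix G :: "'a ugraph"
  assume G: "simple_graph G \<and> card (verts G) = n"
  \<comment> \<open>An extremal \<open>G\<close> has a split Turan graph as distance graph, which
    determines \<open>G\<close> as its complement; conversely each such complement attains the
    maximum.\<close>
  have "extremal 2 n (complete_graph 3) G \<longleftrightarrow> (\<exists>F \<in> split_turan n. G = complement F)"
    using admissible_card_le(2)[OF assms, of G] split_turan_properties(7)[OF _ assms, of _ G]
      admissible_complement_split_turan[OF _ assms] G
    unfolding extremal_def ex_dist_2_triangle[OF assms] by blast
  then show "extremal 2 n (complete_graph 3) G \<longleftrightarrow>
      (\<exists>H :: nat ugraph. H \<in> split_turan n \<and> isomorphic G (complement H))"
    using isomorphic_complement_split_turan_iff[OF _ assms] G by blast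
qed

end
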